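(* Let $N\ge2$, $\gamma\in(0,2)$, $\theta_0\in[0,1]$, $M>1$, $\lambda>0$, $q\ge1$, and let $C_1,C_2,C_3>0$ be constants. Let $c(z)dz$ be a positive Radon measure on $\mathbf{R}^N\setminus\{0\}$ such that $$\int_{\mathbf{R}^N}\min(|z|^2,1)\,c(z)dz\le C_1,\qquad \frac{C_2}{|z|^{N+\gamma}}\le |c(z)|\le \frac{C_3}{|z|^{N+\gamma}}\quad\text{for all } 0<|z|\le 1 .$$ Let $g$ be periodic in $x\in\mathbf{T}^N$ with $|g(x)-g(y)|\le M|x-y|^{\theta_0}$ for all $x,y\in\mathbf{R}^N$, and let $H(p)=|p|^q$ for $p\in\mathbf{R}^N$. Let $v$ be a periodic viscosity solution of $$\lambda v(x)+H(\nabla v(x))-\int_{\mathbf{R}^N}\big[v(x+z)-v(x)-\mathbf{1}_{|z|\le1}\langle\nabla v(x),z\rangle\big]c(z)dz-g(x)=0,\qquad x\in\mathbf{T}^N,$$ satisfying $\sup|v|<M$. Then for any $\theta\in(0,\theta_0)$ there exists a constant $C_\theta>0$ such that $$|v(x)-v(y)|\le\frac{C_\theta}{\lambda}|x-y|^\theta\qquad\text{for all }x,y\in\mathbf{T}^N.$$ The constant $C_\theta$ does not depend on $\lambda\in(0,1)$.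
   Context: $\mathbf{T}^N=\mathbf{R}^N/\mathbf{Z}^N$; functions on $\mathbf{T}^N$ are identified with $\mathbf{Z}^N$-periodic functions on $\mathbf{R}^N$. $\mathbf{S}^N$ is the set of real symmetric $N\times N$ matrices with its usual order; $I$ is the identity matrix. The constant $M$ is a uniform constant, i.e. it does not depend on $\lambda$. For $u$ upper semicontinuous (resp. lower semicontinuous), $J^{2,+}u(\hat x)$ (resp. $J^{2,-}u(\hat x)$) is the second-order superjet (resp. subjet): the set of $(p,X)\in\mathbf{R}^N\times\mathbf{S}^N$ with $u(\hat x+z)\le$ (resp. $\ge$) $u(\hat x)+\langle p,z\rangle+\frac12\langle Xz,z\rangle+o(|z|^2)$ as $z\to0$. Hence for every $\delta>0$ there is $\varepsilon>0$ such that (A) $u(\hat x+z)\le u(\hat x)+\langle p,z\rangle+\frac12\langle Xz,z\rangle+\delta|z|^2$ for $|z|\le\varepsilon$ (resp. (B) $u(\hat x+z)\ge u(\hat x)+\langle p,z\rangle+\frac12\langle Xz,z\rangle-\delta|z|^2$ for $|z|\le\varepsilon$). Definition of viscosity solution. An upper semicontinuous $u$ is a viscosity subsolution of the equation if for any $\hat x$, any $(p,X)\in J^{2,+}u(\hat x)$, any pair of positive numbers $(\varepsilon,\delta)$ satisfying (A), and any $0<\varepsilon'\le\varepsilon$, $$\lambda u(\hat x)+H(p)-\int_{|z|<\varepsilon'}\tfrac12\langle(X+2\delta I)z,z\rangle c(z)dz-\int_{|z|\ge\varepsilon'}[u(\hat x+z)-u(\hat x)-\mathbf{1}_{|z|\le1}\langle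 z,p\rangle]c(z)dz-g(\hat x)\le0.$$ A lower semicontinuous $u$ is a viscosity supersolution if for any $\hat x$, any $(p,X)\in J^{2,-}u(\hat x)$, any pair $(\varepsilon,\delta)$ satisfying (B), and any $0<\varepsilon'\le\varepsilon$, $$\lambda u(\hat x)+H(p)-\int_{|z|<\varepsilon'}\tfrac12\langle(X-2\delta I)z,z\rangle c(z)dz-\int_{|z|\ge\varepsilon'}[u(\hat x+z)-u(\hat x)-\mathbf{1}_{|z|\le1}\langle z,p\rangle]c(z)dz-g(\hat x)\ge0.$$ A viscosity solution is a function that is both a viscosity subsolution and a viscosity supersolution. *)

theory Defs
  imports "HOL-Analysis.Analysis" "HOL-Library.Landau_Symbols"
begin

(* Functions on the torus R^N / Z^N are Z^N-periodic functions on R^N, with N = CARD('n). *)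
definition periodic :: "(real ^ 'n \<Rightarrow> real) \<Rightarrow> bool" where
  "periodic u \<longleftrightarrow> (\<forall>x k. (\<forall>i. k $ i \<in> \<int>) \<longrightarrow> u (x + k) = u x)"

definition usc :: "('a::topological_space \<Rightarrow> real) \<Rightarrow> bool" where
  "usc u \<longleftrightarrow> (\<forall>x. \<forall>a > u x. eventually (\<lambda>y. u y < a) (nhds x))"

definition lsc :: "('a::topological_space \<Rightarrow> real) \<Rightarrow> bool" where
  "lsc u \<longleftrightarrow> (\<forall>x. \<forall>a < u x. eventually (\<lambda>y. a < u y) (nhds x))"

definition sym_matrices :: "(real ^ 'n ^ 'n) set" where
  "sym_matrices = {X. transpose X = X}"

definition taylor2 ::
  "real \<Rightarrow> real ^ 'n \<Rightarrow> real ^ 'n ^ 'n \<Rightarrow> real ^ 'n \<Rightarrow> real" where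
  "taylor2 a p X z = a + p \<bullet> z + 1 / 2 * ((X *v z) \<bullet> z)"

definition superjet ::
  "(real ^ 'n \<Rightarrow> real) \<Rightarrow> real ^ 'n \<Rightarrow> ((real ^ 'n) \<times> (real ^ 'n ^ 'n)) set" where
  "superjet u x = {(p, X). X \<in> sym_matrices \<and>
     (\<exists>r. r \<in> o[at 0](\<lambda>z. norm z ^ 2) \<and>
       (\<forall>\<^sub>F z in at 0. u (x + z) \<le> taylor2 (u x) p X z + r z))}"

definition subjet ::
  "(real ^ 'n \<Rightarrow> real) \<Rightarrow> real ^ 'n \<Rightarrow> ((real ^ 'n) \<times> (real ^ 'n ^ 'n)) set" where
  "subjet u x = {(p, X). X \<in> sym_matrices \<and>
     (\<exists>r. r \<in> o[at 0](\<lambda>z. norm z ^ 2) \<and>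
       (\<forall>\<^sub>F z in at 0. u (x + z) \<ge> taylor2 (u x) p X z + r z))}"

(* The o(|z|^2) in a jet is bounded by del |z|^2 on the closed ball of radius eps; for every
   del > 0 such an eps exists. *)
definition jet_bound_above ::
  "(real ^ 'n \<Rightarrow> real) \<Rightarrow> real ^ 'n \<Rightarrow> real ^ 'n \<Rightarrow> real ^ 'n ^ 'n \<Rightarrow> real \<Rightarrow> real \<Rightarrow> bool" where
  "jet_bound_above u x p X eps del \<longleftrightarrow>
     (\<forall>z. norm z \<le> eps \<longrightarrow> u (x + z) \<le> taylor2 (u x) p X z + del * norm z ^ 2)"

definition jet_bound_below ::
  "(real ^ 'n \<Rightarrow> real) \<Rightarrow> real ^ 'n \<Rightarrow> real ^ 'n \<Rightarrow> real ^ 'n ^ 'n \<Rightarrow> real \<Rightarrow> real \<Rightarrow> bool" where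
  "jet_bound_below u x p X eps del \<longleftrightarrow>
     (\<forall>z. norm z \<le> eps \<longrightarrow> u (x + z) \<ge> taylor2 (u x) p X z - del * norm z ^ 2)"

(* The measure c(z)dz on R^N - {0} is given by a density with respect to Lebesgue measure;
   the value c 0 is irrelevant. *)
definition positive_radon_density :: "(real ^ 'n \<Rightarrow> real) \<Rightarrow> bool" where
  "positive_radon_density c \<longleftrightarrow>
     c \<in> borel_measurable lborel \<and> (AE z in lborel. 0 \<le> c z) \<and>
     (\<forall>K. compact K \<and> 0 \<notin> K \<longrightarrow> set_integrable lborel K c)"

(* Left-hand side of the viscosity inequalities, with splitting radius e. If min(|z|^2,1) c(z) is
   integrable and u is bounded and measurable, both integrals converge absolutely, so the
   convention that a divergent Bochner integral is 0 plays no role; this covers every periodic u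
   that is both upper and lower semicontinuous. *)
definition visc_expr ::
  "(real ^ 'n \<Rightarrow> real) \<Rightarrow> (real ^ 'n \<Rightarrow> real) \<Rightarrow> (real ^ 'n \<Rightarrow> real) \<Rightarrow> real \<Rightarrow>
   (real ^ 'n \<Rightarrow> real) \<Rightarrow> real ^ 'n \<Rightarrow> real ^ 'n \<Rightarrow> real ^ 'n ^ 'n \<Rightarrow> real \<Rightarrow> real" where
  "visc_expr c H g lam u x p Y e =
     lam * u x + H p
     - (LINT z:{z. norm z < e}|lborel. 1 / 2 * ((Y *v z) \<bullet> z) * c z)
     - (LINT z:{z. norm z \<ge> e}|lborel.
          (u (x + z) - u x - indicator {z. norm z \<le> 1} z * (z \<bullet> p)) * c z)
     - g x"

definition visc_subsolution ::
  "(real ^ 'n \<Rightarrow> real) \<Rightarrow> (real ^ 'n \<Rightarrow> real) \<Rightarrow> (real ^ 'n \<Rightarrow> real) \<Rightarrow> real \<Rightarrow>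
   (real ^ 'n \<Rightarrow> real) \<Rightarrow> bool" where
  "visc_subsolution c H g lam u \<longleftrightarrow> usc u \<and>
     (\<forall>x p X eps del eps'. (p, X) \<in> superjet u x \<and> 0 < eps \<and> 0 < del \<and>
        jet_bound_above u x p X eps del \<and> 0 < eps' \<and> eps' \<le> eps \<longrightarrow>
        visc_expr c H g lam u x p (X + (2 * del) *\<^sub>R mat 1) eps' \<le> 0)"

definition visc_supersolution ::
  "(real ^ 'n \<Rightarrow> real) \<Rightarrow> (real ^ 'n \<Rightarrow> real) \<Rightarrow> (real ^ 'n \<Rightarrow> real) \<Rightarrow> real \<Rightarrow>
   (real ^ 'n \<Rightarrow> real) \<Rightarrow> bool" where
  "visc_supersolution c H g lam u \<longleftrightarrow> lsc u \<and>
     (\<forall>x p X eps del eps'. (p, X) \<in> subjet u x \<and> 0 < eps \<and> 0 < del \<and>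
        jet_bound_below u x p X eps del \<and> 0 < eps' \<and> eps' \<le> eps \<longrightarrow>
        visc_expr c H g lam u x p (X - (2 * del) *\<^sub>R mat 1) eps' \<ge> 0)"

definition visc_solution ::
  "(real ^ 'n \<Rightarrow> real) \<Rightarrow> (real ^ 'n \<Rightarrow> real) \<Rightarrow> (real ^ 'n \<Rightarrow> real) \<Rightarrow> real \<Rightarrow>
   (real ^ 'n \<Rightarrow> real) \<Rightarrow> bool" where
  "visc_solution c H g lam u \<longleftrightarrow> visc_subsolution c H g lam u \<and> visc_supersolution c H g lam u"

end

theory Submission
  imports Defs
begin

(* Since H depends on the gradient only and the nonlocal operator commutes with translations, no
   regularising effect of the operator is needed. Maximise v x - v y - K |x - y - h|^2. The penalty
   has the same gradient p at both points, so H p cancels; moving both points by the same z shows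
   that the integrals over |z| >= e have the right sign, and for K fixed the quadratic terms over
   |z| < e vanish as e -> 0. Hence lam (v a - v b) <= g a - g b at the maximum point, and as K tends
   to infinity lam (v (x + h) - v x) <= M |h|^\<theta>\<^sub>0 for all x. *)

section \<open>Continuity of solutions and jets of parabolas\<close>

lemma usc_lsc_imp_continuous_on:
  fixes u :: "'a::topological_space \<Rightarrow> real"
  assumes "usc u" "lsc u"
  shows "continuous_on UNIV u"
proof -
  have "(u \<longlongrightarrow> u x) (nhds x)" for x
    using assms unfolding usc_def lsc_def by (intro order_tendstoI) auto
  then show ?thesis
    by (auto simp: continuous_on_def intro: tendsto_mono[OF at_le] filterlim_mono at_within_le_nhds)
qed

lemma mat_vec_scaleR: "(k *\<^sub>R mat 1 :: real^'n^'n) *v z = k *\<^sub>R z"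
  by (simp add: scaleR_matrix_vector_assoc [symmetric])

lemma scaleR_mat_in_sym_matrices: "k *\<^sub>R mat 1 \<in> sym_matrices"
  by (simp add: sym_matrices_def transpose_def mat_def vec_eq_iff)

lemma taylor2_scaleR_mat: "taylor2 s p ((2 * k) *\<^sub>R mat 1) z = s + p \<bullet> z + k * norm z ^ 2"
  unfolding taylor2_def mat_vec_scaleR inner_scaleR_left power2_norm_eq_inner by simp

text \<open>A global parabola leaves nothing for the remainder, so \<open>r\<close> is zero. The
  matrix is \<open>2 * K\<close> times the identity because \<open>taylor2\<close> halves the
  quadratic form. \<open>K\<close> may have either sign; the subjet version is used with a negative
  one.\<close>

lemma superjet_quadratic:
  assumes "\<And>z. u (a + z) \<le> u a + p \<bullet> z + K * norm z ^ 2"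
  shows "(p, (2 * K) *\<^sub>R mat 1) \<in> superjet u a"
  unfolding superjet_def using assms
  by (intro CollectI case_prodI conjI scaleR_mat_in_sym_matrices exI[of _ "\<lambda>_. 0"] always_eventually)
     (simp_all only: taylor2_scaleR_mat add_0_right zero_in_smallo simp_thms)

lemma subjet_quadratic:
  assumes "\<And>z. u (a + z) \<ge> u a + p \<bullet> z + K * norm z ^ 2"
  shows "(p, (2 * K) *\<^sub>R mat 1) \<in> subjet u a"
  unfolding subjet_def using assms
  by (intro CollectI case_prodI conjI scaleR_mat_in_sym_matrices exI[of _ "\<lambda>_. 0"] always_eventually)
     (simp_all only: taylor2_scaleR_mat add_0_right zero_in_smallo simp_thms)

section \<open>Nonlocal terms and the doubling inequality\<close>

context
  fixes c :: "real^'n \<Rightarrow> real"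
  assumes c_meas: "c \<in> borel_measurable lborel"
    and c_nonneg: "AE z in lborel. 0 \<le> c z"
    and c_int: "integrable lborel (\<lambda>z. min (norm z ^ 2) 1 * c z)"
begin

text \<open>Away from the origin the weight \<open>min (norm z ^ 2) 1\<close> is at least
  \<open>min (e ^ 2) 1\<close>, so dividing by this constant turns \<open>c_int\<close> into an
  integrable majorant.\<close>

lemma set_integrable_tail:
  assumes f: "f \<in> borel_measurable borel" and B: "\<And>z. \<bar>f z\<bar> \<le> B" and e: "0 < e"
  shows "set_integrable lborel {z. norm z \<ge> e} (\<lambda>z. f z * c z)"
proof -
  let ?m = "min (e ^ 2) 1"
  have m: "?m > 0" using e by simp
  have B0: "0 \<le> B" using B[of 0] by linarith
  have "\<bar>f z * c z\<bar> \<le> B / ?m * \<bar>min (norm z ^ 2) 1 * c z\<bar>" if "e \<le> norm z" for z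
  proof -
    have "?m \<le> min (norm z ^ 2) 1" using that e by (simp add: min_le_iff_disj power_mono)
    then have "1 \<le> min (norm z ^ 2) 1 / ?m" using m by simp
    then have "B * 1 \<le> B * (min (norm z ^ 2) 1 / ?m)" using B0 by (rule mult_left_mono)
    then have "\<bar>f z\<bar> * \<bar>c z\<bar> \<le> B * (min (norm z ^ 2) 1 / ?m) * \<bar>c z\<bar>"
      using B[of z] by (intro mult_right_mono) auto
    then show ?thesis by (simp add: abs_mult)
  qed
  then show ?thesis
    unfolding set_integrable_def
    using f c_meas B0 m
    by (intro Bochner_Integration.integrable_bound[OF integrable_mult_right[OF integrable_abs[OF c_int], of "B / ?m"]])
       (auto split: split_indicator)
qed

text \<open>Dominated convergence: every radius is at most 1, so inside the ball
  \<open>norm z ^ 2\<close> equals the weight in \<open>c_int\<close>. For each \<open>z\<close> the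
  integrand is eventually zero, and at the origin it is zero from the start.\<close>

lemma small_ball_tendsto:
  "((\<lambda>n. LINT z:{z. norm z < 1 / real (Suc n)}|lborel. norm z ^ 2 * c z) \<longlonglongrightarrow> 0)"
proof -
  have "(\<lambda>n. LINT z|lborel. indicator {z. norm z < 1 / real (Suc n)} z *\<^sub>R (norm z ^ 2 * c z))
    \<longlonglongrightarrow> (LINT z|(lborel::(real^'n) measure). 0)"
  proof (rule integral_dominated_convergence[OF _ _ integrable_abs[OF c_int]])
    fix n
    show "AE z in lborel. norm (indicator {z. norm z < 1 / real (Suc n)} z *\<^sub>R (norm z ^ 2 * c z))
      \<le> \<bar>min (norm z ^ 2) 1 * c z\<bar>"
    proof (rule AE_I2)
      fix z :: "real^'n"
      have "norm z ^ 2 \<le> 1" if "norm z < 1 / real (Suc n)"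
      proof -
        have "1 / real (Suc n) \<le> 1" by simp
        with that have "norm z \<le> 1" by (rule less_imp_le[OF less_le_trans])
        then show ?thesis by (intro power_le_one) auto
      qed
      then show "norm (indicator {z. norm z < 1 / real (Suc n)} z *\<^sub>R (norm z ^ 2 * c z))
        \<le> \<bar>min (norm z ^ 2) 1 * c z\<bar>"
        by (auto split: split_indicator)
    qed
  next
    show "AE z in lborel. (\<lambda>n. indicator {z. norm z < 1 / real (Suc n)} z *\<^sub>R (norm z ^ 2 * c z)) \<longlonglongrightarrow> 0"
    proof (rule AE_I2)
      fix z :: "real^'n"
      show "(\<lambda>n. indicator {z. norm z < 1 / real (Suc n)} z *\<^sub>R (norm z ^ 2 * c z)) \<longlonglongrightarrow> 0"
      proof (cases "z = 0")
        case False
        have "\<forall>\<^sub>F n in sequentially. 1 / real (Suc n) < norm z"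
          using False LIMSEQ_inverse_real_of_nat
          by (auto simp: inverse_eq_divide dest!: order_tendstoD(2)[of _ _ _ "norm z"])
        then have "\<forall>\<^sub>F n in sequentially.
            indicator {z. norm z < 1 / real (Suc n)} z *\<^sub>R (norm z ^ 2 * c z) = 0"
          by eventually_elim auto
        then show ?thesis by (rule tendsto_eventually)
      qed simp
    qed
  qed (use c_meas in auto)
  then show ?thesis by (simp add: set_lebesgue_integral_def)
qed

text \<open>Comparison at a global maximum point of the doubled function. \<open>H\<close> can be
  arbitrary, since both viscosity inequalities are tested with the same gradient.\<close>

lemma visc_doubling:
  fixes u w g\<^sub>1 g\<^sub>2 H :: "real^'n \<Rightarrow> real"
  assumes sub: "visc_subsolution c H g\<^sub>1 lam u" and super: "visc_supersolution c H g\<^sub>2 lam w"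
    and meas [measurable]: "u \<in> borel_measurable borel" "w \<in> borel_measurable borel"
    and bdd: "\<And>x. \<bar>u x\<bar> \<le> B" "\<And>x. \<bar>w x\<bar> \<le> B"
    and max: "\<And>x y. u x - w y - K * norm (x - y - h) ^ 2 \<le> u a - w b - K * norm (a - b - h) ^ 2"
  shows "lam * (u a - w b) \<le> g\<^sub>1 a - g\<^sub>2 b"
proof -
  \<comment> \<open>\<open>p\<close> is the gradient of the penalty in \<open>x\<close> and minus
    its gradient in \<open>y\<close>. Freezing one variable in \<open>max\<close> and expanding the
    square gives a parabola above \<open>u\<close> at \<open>a\<close> and one below
    \<open>w\<close> at \<open>b\<close>, with common slope \<open>p\<close> and curvatures given by
    \<open>K\<close> and \<open>- K\<close>.\<close>
  define d p where "d = a - b - h" and "p = (2 * K) *\<^sub>R d"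
  define S where "S e = (LINT z:{z. norm z < e}|lborel. norm z ^ 2 * c z)" for e
  have u_le: "u (a + z) \<le> u a + p \<bullet> z + K * norm z ^ 2" for z
  proof -
    have *: "a + z - b - h = d + z" by (simp add: d_def)
    show ?thesis using max[of "a + z" b] unfolding * d_def[symmetric]
      by (simp add: p_def power2_norm_eq_inner inner_add_left inner_add_right inner_commute algebra_simps)
  qed
  have w_ge: "w (b + z) \<ge> w b + p \<bullet> z + (- K) * norm z ^ 2" for z
  proof -
    have *: "a - (b + z) - h = d - z" by (simp add: d_def)
    show ?thesis using max[of a "b + z"] unfolding * d_def[symmetric]
      by (simp add: p_def power2_norm_eq_inner inner_diff_left inner_diff_right inner_commute algebra_simps)
  qed
  have shift: "u (a + z) - u a \<le> w (b + z) - w b" for z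
    using max[of "a + z" "b + z"] by simp
  \<comment> \<open>Each point contributes an error \<open>(K + 1) * S e\<close>: \<open>K\<close>
    from its parabola and 1 from the choice \<open>del = 1\<close>.\<close>
  have ineq: "lam * (u a - w b) \<le> g\<^sub>1 a - g\<^sub>2 b + (2 * K + 2) * S e" if e: "0 < e" "e \<le> 1" for e
  proof -
    let ?F = "\<lambda>u x z. u (x + z) - u x - indicator {z. norm z \<le> 1} z * (z \<bullet> p)"
    have quad: "(LINT z:{z. norm z < e}|lborel. 1 / 2 * ((((2 * k) *\<^sub>R mat 1 :: real^'n^'n) *v z) \<bullet> z) * c z)
        = k * S e" for k
      unfolding S_def
      by (subst set_integral_mult_right [symmetric])
         (simp add: mat_vec_scaleR power2_norm_eq_inner mult.assoc)
    \<comment> \<open>Since \<open>u_le\<close> holds for all \<open>z\<close>, the pair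
      \<open>eps = 1\<close>, \<open>del = 1\<close> is admissible, which allows every splitting
      radius \<open>e \<le> 1\<close>.\<close>
    have "jet_bound_above u a p ((2 * K) *\<^sub>R mat 1) 1 1"
      unfolding jet_bound_above_def taylor2_scaleR_mat
      by (auto intro!: order_trans[OF u_le])
    then have "visc_expr c H g\<^sub>1 lam u a p ((2 * K) *\<^sub>R mat 1 + (2 * 1) *\<^sub>R mat 1) e \<le> 0"
      using sub superjet_quadratic[OF u_le] e unfolding visc_subsolution_def by (meson zero_less_one)
    moreover have "(2 * K) *\<^sub>R mat 1 + (2 * 1) *\<^sub>R mat 1 = ((2 * (K + 1)) *\<^sub>R mat 1 :: real^'n^'n)"
      by (simp only: scaleR_left_distrib [symmetric] distrib_left)
    ultimately have 1: "lam * u a + H p - (K + 1) * S e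
        - (LINT z:{z. norm z \<ge> e}|lborel. ?F u a z * c z) - g\<^sub>1 a \<le> 0"
      by (simp only: visc_expr_def quad)
    have "jet_bound_below w b p ((2 * - K) *\<^sub>R mat 1) 1 1"
      unfolding jet_bound_below_def taylor2_scaleR_mat
      by (auto intro!: order_trans[OF _ w_ge])
    then have "visc_expr c H g\<^sub>2 lam w b p ((2 * - K) *\<^sub>R mat 1 - (2 * 1) *\<^sub>R mat 1) e \<ge> 0"
      using super subjet_quadratic[OF w_ge] e unfolding visc_supersolution_def by (meson zero_less_one)
    moreover have "(2 * - K) *\<^sub>R mat 1 - (2 * 1) *\<^sub>R mat 1 = ((2 * - (K + 1)) *\<^sub>R mat 1 :: real^'n^'n)"
      by (simp only: scaleR_left_diff_distrib [symmetric]) simp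
    ultimately have 2: "lam * w b + H p - (- (K + 1)) * S e
        - (LINT z:{z. norm z \<ge> e}|lborel. ?F w b z * c z) - g\<^sub>2 b \<ge> 0"
      by (simp only: visc_expr_def quad)
    have int: "set_integrable lborel {z. norm z \<ge> e} (\<lambda>z. ?F f x z * c z)"
      if [measurable]: "f \<in> borel_measurable borel" and f: "\<And>x. \<bar>f x\<bar> \<le> B" for f x
    proof (rule set_integrable_tail[OF _ _ e(1)])
      fix z
      have "\<bar>indicator {z. norm z \<le> 1} z * (z \<bullet> p)\<bar> \<le> norm p"
      proof -
        have "\<bar>z \<bullet> p\<bar> \<le> 1 * norm p" if "norm z \<le> 1"
          using Cauchy_Schwarz_ineq2[of z p] mult_right_mono[OF that, of "norm p"] by auto
        then show ?thesis by (auto split: split_indicator)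
      qed
      then show "\<bar>?F f x z\<bar> \<le> 2 * B + norm p"
        using f[of "x + z"] f[of x] by linarith
    next
      have "(\<lambda>z. f (x + z)) \<in> borel_measurable borel" by measurable
      moreover have "{z :: real^'n. norm z \<le> 1} \<in> sets borel" by measurable
      ultimately show "?F f x \<in> borel_measurable borel"
        by (intro borel_measurable_diff borel_measurable_times borel_measurable_indicator
            borel_measurable_inner borel_measurable_const measurable_ident_sets[OF refl])
    qed
    \<comment> \<open>The compensators contain the same \<open>p\<close> and agree, so
      \<open>shift\<close> orders the integrands wherever \<open>c\<close> is nonnegative.\<close>
    have "(LINT z:{z. norm z \<ge> e}|lborel. ?F u a z * c z) \<le> (LINT z:{z. norm z \<ge> e}|lborel. ?F w b z * c z)"
    proof (rule set_integral_mono_AE[OF int[OF meas(1) bdd(1)] int[OF meas(2) bdd(2)]])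
      show "AE z\<in>{z. norm z \<ge> e} in lborel. ?F u a z * c z \<le> ?F w b z * c z"
        using c_nonneg by eventually_elim (auto intro!: mult_right_mono shift)
    qed
    with 1 2 show ?thesis by (simp add: algebra_simps)
  qed
  have "(\<lambda>n. g\<^sub>1 a - g\<^sub>2 b + (2 * K + 2) * S (1 / real (Suc n))) \<longlonglongrightarrow> g\<^sub>1 a - g\<^sub>2 b + (2 * K + 2) * 0"
    using small_ball_tendsto unfolding S_def by (intro tendsto_intros)
  then show ?thesis
    using ineq by (intro LIMSEQ_le_const[where X = "\<lambda>n. g\<^sub>1 a - g\<^sub>2 b + (2 * K + 2) * S (1 / real (Suc n))"]) auto
qed

end

section \<open>Existence of maximum points\<close>

lemma integer_translate_in_unit_cube:
  fixes x :: "real^'n"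
  obtains k where "\<And>i. k $ i \<in> \<int>" "x + k \<in> cbox 0 1"
proof
  show "(\<chi> i. - of_int \<lfloor>x $ i\<rfloor>) $ i \<in> \<int>" for i by simp
  show "x + (\<chi> i. - of_int \<lfloor>x $ i\<rfloor>) \<in> cbox 0 1"
    by (auto simp: mem_box_cart) linarith+
qed

text \<open>In the variables \<open>x\<close> and \<open>s = x - y - h\<close> the doubled function
  is periodic in \<open>x\<close> for fixed \<open>s\<close>, while the penalty excludes large
  \<open>s\<close>. A maximum over the unit cube times a ball is therefore global.\<close>

lemma doubling_maximum_exists:
  fixes u w :: "real^'n \<Rightarrow> real"
  assumes cont: "continuous_on UNIV u" "continuous_on UNIV w"
    and per: "periodic u" "periodic w"
    and bdd: "\<And>x. \<bar>u x\<bar> \<le> B" "\<And>x. \<bar>w x\<bar> \<le> B" and K: "0 < K"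
  obtains a b where
    "\<And>x y. u x - w y - K * norm (x - y - h) ^ 2 \<le> u a - w b - K * norm (a - b - h) ^ 2"
    "K * norm (a - b - h) ^ 2 \<le> 4 * B"
proof -
  \<comment> \<open>\<open>R\<close> solves \<open>K * R ^ 2 = 4 * B\<close>. As
    \<open>u - w\<close> takes values between \<open>- 2 * B\<close> and \<open>2 * B\<close>, a
    larger \<open>s\<close> pushes \<open>\<Phi>\<close> down to at most \<open>- 2 * B\<close>,
    which is no more than its value at the origin.\<close>
  define R where "R = sqrt (4 * B / K)"
  define \<Phi> where "\<Phi> q = u (fst q) - w (fst q - snd q - h) - K * norm (snd q) ^ 2" for q
  have B0: "0 \<le> B" using bdd(1)[of 0] by linarith
  let ?A = "cbox 0 1 \<times> cball 0 R :: ((real^'n) \<times> (real^'n)) set"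
  have contu: "continuous_on S (\<lambda>q. u (f q))" if "continuous_on S f" for S and f :: "(real^'n) \<times> (real^'n) \<Rightarrow> _"
    using continuous_on_compose2[OF cont(1) that] by auto
  have contw: "continuous_on S (\<lambda>q. w (f q))" if "continuous_on S f" for S and f :: "(real^'n) \<times> (real^'n) \<Rightarrow> _"
    using continuous_on_compose2[OF cont(2) that] by auto
  have "continuous_on ?A \<Phi>"
    unfolding \<Phi>_def by (intro continuous_intros contu contw)
  moreover have "compact ?A" by (intro compact_Times) auto
  moreover have mem0: "(0, 0) \<in> ?A" using B0 K by (auto simp: R_def mem_box_cart)
  ultimately obtain q where q: "q \<in> ?A" "\<And>r. r \<in> ?A \<Longrightarrow> \<Phi> r \<le> \<Phi> q"
    using continuous_attains_sup[of ?A \<Phi>] by blast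
  have \<Phi>0: "- 2 * B \<le> \<Phi> (0, 0)"
    using bdd(1)[of 0] bdd(2)[of "0 - 0 - h"] by (simp add: \<Phi>_def)
  have far: "\<Phi> (x, s) \<le> \<Phi> q" if "norm s > R" for x s
  proof -
    have "R ^ 2 = 4 * B / K" using B0 K by (simp add: R_def)
    moreover have "R ^ 2 \<le> norm s ^ 2"
      using that B0 K by (intro power_mono) (auto simp: R_def)
    ultimately have "4 * B \<le> K * norm s ^ 2" using K by (simp add: pos_divide_le_eq mult.commute)
    then have "\<Phi> (x, s) \<le> - 2 * B"
      using bdd(1)[of x] bdd(2)[of "x - s - h"] by (simp add: \<Phi>_def)
    then show ?thesis using \<Phi>0 q(2)[OF mem0] by linarith
  qed
  have \<Phi>_max: "\<Phi> (x, s) \<le> \<Phi> q" for x s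
  proof (cases "norm s > R")
    case False
    obtain k where k: "\<And>i. k $ i \<in> \<int>" "x + k \<in> cbox 0 1"
      using integer_translate_in_unit_cube by blast
    have "u (x + k) = u x" "w (x - s - h + k) = w (x - s - h)"
      using per k(1) by (auto simp: periodic_def)
    moreover have "x + k - s - h = x - s - h + k" by simp
    ultimately have "\<Phi> (x, s) = \<Phi> (x + k, s)" unfolding \<Phi>_def fst_conv snd_conv by presburger
    also have "\<dots> \<le> \<Phi> q" using q(2)[of "(x + k, s)"] k(2) False by simp
    finally show ?thesis .
  qed (rule far)
  show ?thesis
  proof (rule that[of "fst q" "fst q - snd q - h"])
    fix x y
    show "u x - w y - K * norm (x - y - h) ^ 2 \<le> u (fst q) - w (fst q - snd q - h)
        - K * norm (fst q - (fst q - snd q - h) - h) ^ 2"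
      using \<Phi>_max[of x "x - y - h"] by (simp add: \<Phi>_def)
    \<comment> \<open>Comparison with the origin also bounds the penalty: it is at most
      \<open>2 * B\<close> plus a difference of values that is itself at most
      \<open>2 * B\<close>.\<close>
    have "- 2 * B \<le> \<Phi> q" using \<Phi>0 q(2)[OF mem0] by linarith
    then show "K * norm (fst q - (fst q - snd q - h) - h) ^ 2 \<le> 4 * B"
      using bdd(1)[of "fst q"] bdd(2)[of "fst q - snd q - h"] by (simp add: \<Phi>_def)
  qed
qed

section \<open>The estimate with the exponent of \<open>g\<close>\<close>

lemma visc_solution_Hoelder:
  fixes c g H v :: "real^'n \<Rightarrow> real"
  assumes c: "c \<in> borel_measurable lborel" "AE z in lborel. 0 \<le> c z"
      "integrable lborel (\<lambda>z. min (norm z ^ 2) 1 * c z)"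
    and g: "\<And>x y. \<bar>g x - g y\<bar> \<le> M * norm (x - y) powr \<alpha>"
    and \<alpha>: "0 < \<alpha>" and lam: "0 < lam"
    and v: "periodic v" "visc_solution c H g lam v" "\<And>x. \<bar>v x\<bar> \<le> B"
  shows "v x - v y \<le> M / lam * norm (x - y) powr \<alpha>"
proof -
  have sub: "visc_subsolution c H g lam v" and super: "visc_supersolution c H g lam v"
    using v(2) by (auto simp: visc_solution_def)
  then have cont: "continuous_on UNIV v"
    by (auto simp: visc_subsolution_def visc_supersolution_def intro: usc_lsc_imp_continuous_on)
  then have meas: "v \<in> borel_measurable borel" by (rule borel_measurable_continuous_onI)
  \<comment> \<open>The two points have distance 1, so the right-hand side of \<open>g\<close> is
    \<open>M\<close> itself.\<close>
  have M: "0 \<le> M" using g[of "axis undefined 1" 0] by simp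
  define h where "h = x - y"
  \<comment> \<open>With \<open>h = x - y\<close> the penalty vanishes at \<open>(x, y)\<close>, so
    \<open>v x - v y\<close> is at most the maximum. The penalty bound keeps \<open>a - b\<close>
    within \<open>sqrt (4 * B / K)\<close> of \<open>h\<close>, where
    \<open>K = real (Suc n)\<close>.\<close>
  have bound: "lam * (v x - v y) \<le> M * (norm h + sqrt (4 * B / real (Suc n))) powr \<alpha>" for n
  proof -
    obtain a b where max: "\<And>x y. v x - v y - real (Suc n) * norm (x - y - h) ^ 2
        \<le> v a - v b - real (Suc n) * norm (a - b - h) ^ 2"
      and pen: "real (Suc n) * norm (a - b - h) ^ 2 \<le> 4 * B"
      by (rule doubling_maximum_exists[OF cont cont v(1) v(1) v(3) v(3), of "real (Suc n)" h]) auto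
    have "0 \<le> real (Suc n) * norm (a - b - h) ^ 2" by simp
    moreover have "real (Suc n) * norm (x - y - h) ^ 2 = 0" by (simp add: h_def)
    ultimately have "v x - v y \<le> v a - v b" using max[of x y] by linarith
    then have "lam * (v x - v y) \<le> lam * (v a - v b)" using lam by simp
    also have "\<dots> \<le> g a - g b"
      by (rule visc_doubling[OF c sub super meas meas v(3) v(3) max])
    also have "\<dots> \<le> M * norm (a - b) powr \<alpha>" using g[of a b] by linarith
    also have "\<dots> \<le> M * (norm h + sqrt (4 * B / real (Suc n))) powr \<alpha>"
    proof -
      have "norm (a - b - h) ^ 2 \<le> 4 * B / real (Suc n)" using pen by (simp add: field_simps)
      then have "norm (a - b - h) \<le> sqrt (4 * B / real (Suc n))" by (rule real_le_rsqrt)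
      then have "norm (a - b) \<le> norm h + sqrt (4 * B / real (Suc n))"
        using norm_triangle_sub[of "a - b" h] by linarith
      then show ?thesis using M \<alpha> by (intro mult_left_mono powr_mono2) auto
    qed
    finally show ?thesis .
  qed
  have "(\<lambda>n. sqrt (4 * B * inverse (real (Suc n)))) \<longlonglongrightarrow> sqrt (4 * B * 0)"
    by (intro tendsto_intros LIMSEQ_inverse_real_of_nat)
  then have "(\<lambda>n. norm h + sqrt (4 * B / real (Suc n))) \<longlonglongrightarrow> norm h + 0"
    by (intro tendsto_intros) (simp add: divide_inverse)
  \<comment> \<open>Nonnegative bases together with \<open>0 < \<alpha>\<close> give convergence of
    the powers even when \<open>h = 0\<close>.\<close>
  moreover have "0 \<le> B" using v(3)[of 0] by linarith
  ultimately have "(\<lambda>n. M * (norm h + sqrt (4 * B / real (Suc n))) powr \<alpha>) \<longlonglongrightarrow> M * (norm h + 0) powr \<alpha>"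
    using \<alpha> by (intro tendsto_mult tendsto_powr' tendsto_const) auto
  then have "lam * (v x - v y) \<le> M * (norm h + 0) powr \<alpha>"
    using bound by (intro LIMSEQ_le_const) auto
  then show ?thesis using lam by (simp add: h_def field_simps)
qed

section \<open>Passage to smaller exponents\<close>

theorem theorem4p1:
  fixes c g H :: "real ^ 'n \<Rightarrow> real"
    and \<gamma> \<theta>\<^sub>0 M q C\<^sub>1 C\<^sub>2 C\<^sub>3 :: real
  assumes "CARD('n) \<ge> 2"
    and "0 < \<gamma>" and "\<gamma> < 2"
    and "0 \<le> \<theta>\<^sub>0" and "\<theta>\<^sub>0 \<le> 1"
    and "M > 1" and "q \<ge> 1"
    and "C\<^sub>1 > 0" and "C\<^sub>2 > 0" and "C\<^sub>3 > 0"
    and "positive_radon_density c"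
    and "(\<integral>\<^sup>+ z. ennreal (min (norm z ^ 2) 1 * c z) \<partial>lborel) \<le> ennreal C\<^sub>1"
    and "\<And>z. 0 < norm z \<Longrightarrow> norm z \<le> 1 \<Longrightarrow>
           C\<^sub>2 / norm z powr (real CARD('n) + \<gamma>) \<le> \<bar>c z\<bar> \<and>
           \<bar>c z\<bar> \<le> C\<^sub>3 / norm z powr (real CARD('n) + \<gamma>)"
    and "periodic g"
    and "\<And>x y. \<bar>g x - g y\<bar> \<le> M * norm (x - y) powr \<theta>\<^sub>0"
    and "\<And>p. H p = norm p powr q"
  shows "\<forall>\<theta>. 0 < \<theta> \<and> \<theta> < \<theta>\<^sub>0 \<longrightarrow>
    (\<exists>C :: real \<Rightarrow> real.
       (\<forall>lam > 0. C lam > 0 \<and>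
          (\<forall>v. periodic v \<and> visc_solution c H g lam v \<and>
               bdd_above (range (\<lambda>x. \<bar>v x\<bar>)) \<and> (SUP x. \<bar>v x\<bar>) < M \<longrightarrow>
               (\<forall>x y. \<bar>v x - v y\<bar> \<le> C lam / lam * norm (x - y) powr \<theta>))) \<and>
       C constant_on {0<..<1})"


proof (intro allI impI)
  fix \<theta> :: real
  assume \<theta>: "0 < \<theta> \<and> \<theta> < \<theta>\<^sub>0"
  have c: "c \<in> borel_measurable lborel" "AE z in lborel. 0 \<le> c z"
    using assms(11) by (auto simp: positive_radon_density_def)
  \<comment> \<open>\<open>ennreal\<close> truncates negative values to 0, so the finite integral
    yields integrability only together with the sign of \<open>c\<close>.\<close>
  have c_int: "integrable lborel (\<lambda>z. min (norm z ^ 2) 1 * c z)"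
  proof (rule integrableI_nonneg)
    show "(\<lambda>z. min (norm z ^ 2) 1 * c z) \<in> borel_measurable lborel" using c(1) by measurable
    show "AE z in lborel. 0 \<le> min (norm z ^ 2) 1 * c z" using c(2) by eventually_elim auto
    show "(\<integral>\<^sup>+ z. ennreal (min (norm z ^ 2) 1 * c z) \<partial>lborel) < \<infinity>"
      using assms(12) by (simp add: le_less_trans)
  qed
  \<comment> \<open>At distance at most 1, lowering the exponent enlarges the power, and
    \<open>C lam \<ge> M\<close> is enough. At larger distance the sup bound gives
    \<open>2 * M\<close>, which calls for \<open>C lam / lam \<ge> 2 * M\<close>; the factor
    \<open>max 1 lam\<close> ensures this and equals 1 for \<open>lam < 1\<close>.\<close>
  define C where "C lam = 2 * M * max 1 lam" for lam :: real
  have "\<bar>v x - v y\<bar> \<le> C lam / lam * norm (x - y) powr \<theta>"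
    if lam: "lam > 0" and v: "periodic v" "visc_solution c H g lam v"
      "bdd_above (range (\<lambda>x. \<bar>v x\<bar>))" "(SUP x. \<bar>v x\<bar>) < M" for lam v x y
  proof -
    have vM: "\<bar>v x\<bar> \<le> M" for x
      using cSUP_upper[OF UNIV_I v(3), of x] v(4) by linarith
    have H: "v x - v y \<le> M / lam * norm (x - y) powr \<theta>\<^sub>0" for x y
      using \<theta> by (intro visc_solution_Hoelder[OF c c_int assms(15) _ lam v(1,2) vM]) auto
    show ?thesis
    proof (cases "norm (x - y) \<le> 1")
      case True
      have "M * 1 \<le> M * (2 * max 1 lam)" using assms(6) by (intro mult_left_mono) auto
      then have MC: "M / lam \<le> C lam / lam"
        using lam by (intro divide_right_mono) (auto simp: C_def)
      have "\<bar>v x - v y\<bar> \<le> M / lam * norm (x - y) powr \<theta>\<^sub>0"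
        using H[of x y] H[of y x] by (simp add: norm_minus_commute abs_le_iff)
      also have "\<dots> \<le> C lam / lam * norm (x - y) powr \<theta>"
        using MC assms(6) lam True \<theta>
        by (intro mult_mono powr_mono') (auto simp: C_def)
      finally show ?thesis .
    next
      case False
      have "\<bar>v x - v y\<bar> \<le> 2 * M * 1" using vM[of x] vM[of y] by linarith
      also have "\<dots> \<le> 2 * M * (max 1 lam / lam)" using lam assms(6) by (intro mult_left_mono) auto
      also have "\<dots> = C lam / lam * 1" by (simp add: C_def)
      also have "\<dots> \<le> C lam / lam * norm (x - y) powr \<theta>"
        using False \<theta> lam assms(6)
        by (intro mult_left_mono ge_one_powr_ge_zero) (auto simp: C_def)
      finally show ?thesis .
    qed
  qed
  moreover have "C lam > 0" for lam using assms(6) by (auto simp: C_def)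
  moreover have "C constant_on {0<..<1}"
    by (auto simp: constant_on_def C_def intro!: exI[of _ "2 * M"])
  ultimately show "\<exists>C :: real \<Rightarrow> real.
       (\<forall>lam > 0. C lam > 0 \<and>
          (\<forall>v. periodic v \<and> visc_solution c H g lam v \<and>
               bdd_above (range (\<lambda>x. \<bar>v x\<bar>)) \<and> (SUP x. \<bar>v x\<bar>) < M \<longrightarrow>
               (\<forall>x y. \<bar>v x - v y\<bar> \<le> C lam / lam * norm (x - y) powr \<theta>))) \<and>
       C constant_on {0<..<1}"
    by (intro exI[of _ C] conjI allI impI) simp_all
qed

end
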